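(* Let the hyperparameters satisfy either (i) $a>0$, $b\ge 0$, $\gamma>0$ (log-adjusted shrinkage prior), or (ii) $a>0$, $b>0$, $\gamma=-1$ (beta-type prior). Consider the model $y\mid\theta\sim N(\theta,1)$, $\theta\mid u\sim N(0,u)$, with $u>0$ having probability density proportional to $$u^{a-1}(1+u)^{-(a+b)}\{1+\log(1+u)\}^{-(1+\gamma)} .$$ Let $\mathrm{MSE}_\pi(\theta\mid y)=E_\pi[(\theta-y)^2\mid y]$ be the posterior mean squared error. Then $$\mathrm{MSE}_\pi(\theta\mid y)=1+\frac{2}{y^2}(1+b)(1+2b)+o\!\left(\frac1{y^2}\right)\qquad\text{as } |y|\to\infty,$$ where $y^2\,o(1/y^2)\to0$ as $|y|\to\infty$.
   Context: $N(\mu,\sigma^2)$ denotes the normal distribution with mean $\mu$ and variance $\sigma^2$. The expectation $E_\pi[\,\cdot\mid y]$ is taken under the posterior distribution of $\theta$ given the scalar observation $y$, where the prior of $\theta$ is the normal scale mixture obtained by integrating out $u$. *)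

theory Defs
  imports "HOL-Probability.Probability" "HOL-Library.Landau_Symbols"
begin

definition mixing_kernel :: "real \<Rightarrow> real \<Rightarrow> real \<Rightarrow> real \<Rightarrow> real" where
  "mixing_kernel a b \<gamma> u =
     u powr (a - 1) * (1 + u) powr (- (a + b)) * (1 + ln (1 + u)) powr (- (1 + \<gamma>))
       * indicator {0<..} u"

definition mixing_law :: "real \<Rightarrow> real \<Rightarrow> real \<Rightarrow> real measure" where
  "mixing_law a b \<gamma> =
     density lborel (\<lambda>u. ennreal (mixing_kernel a b \<gamma> u)
       / (\<integral>\<^sup>+ v. ennreal (mixing_kernel a b \<gamma> v) \<partial>lborel))"

(* The second argument of normal_density is the standard deviation, hence sqrt u for
   variance u.  The mixture density is taken in ennreal because it may be infinite at
   theta = 0 (when a <= 1/2). *)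
definition normal_scale_mixture :: "real measure \<Rightarrow> real measure" where
  "normal_scale_mixture U =
     density lborel (\<lambda>\<theta>. \<integral>\<^sup>+ u. ennreal (normal_density 0 (sqrt u) \<theta>) \<partial>U)"

(* Bayes' formula for the likelihood y | theta ~ N(theta, 1), giving a version of the
   conditional law of theta that is defined for every y. *)
definition posterior :: "real measure \<Rightarrow> real \<Rightarrow> real measure" where
  "posterior P y =
     density P (\<lambda>\<theta>. ennreal (normal_density \<theta> 1 y)
       / (\<integral>\<^sup>+ t. ennreal (normal_density t 1 y) \<partial>P))"

definition posterior_mse :: "real measure \<Rightarrow> real \<Rightarrow> real" where
  "posterior_mse P y = (\<integral>\<theta>. (\<theta> - y)\<^sup>2 \<partial>posterior P y)"

end

theory Submission
  imports Defs "HOL-Real_Asymp.Real_Asymp"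
begin

text \<open>
  Given \<open>u\<close>, the posterior of \<open>\<theta>\<close> is normal with mean \<open>y u / (1 + u)\<close> and variance
  \<open>u / (1 + u)\<close>. Hence with \<open>\<kappa> = 1 / (1 + u)\<close> the posterior mean squared error is the average of
  \<open>1 - \<kappa> + y\<^sup>2 \<kappa>\<^sup>2\<close> under the posterior of \<open>u\<close>, whose density is proportional to the mixing kernel
  times \<open>\<kappa> powr (1/2) * exp (- t \<kappa>)\<close>, where \<open>t = y\<^sup>2 / 2\<close>.

  Write \<open>J s t\<close> for the integral of the kernel times \<open>\<kappa> powr s * exp (- t \<kappa>)\<close>. Only large \<open>u\<close>
  matters as \<open>t\<close> grows, and there the linear rescaling \<open>1 + u = t x\<close> with dominated convergence shows that
  \<open>t powr (b + s) * (1 + ln t) powr (1 + \<gamma>) * J s t\<close> tends to \<open>I (b + s)\<close>, where \<open>I r\<close> is the integral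
  of \<open>x powr (- r - 1) * exp (- 1 / x)\<close> over the positive reals. (In fact \<open>I\<close> is the Gamma function,
  but only \<open>I (r + 1) = r I r\<close> is needed.) With \<open>r = b + 1/2\<close> it follows that
  \<open>y\<^sup>2 (MSE - 1)\<close> tends to \<open>4 r (r + 1) - 2 r = 2 (1 + b) (1 + 2 b)\<close>.
\<close>

section \<open>Convergent model integrals at zero and at infinity\<close>

lemma set_integrable_powr_at_0:
  fixes a :: real
  assumes "a > 0"
  shows "set_integrable lborel {0<..<1} (\<lambda>x. x powr (a - 1))"
proof -
  have "set_integrable lborel (einterval 0 1) (\<lambda>x. x powr (a - 1))"
  proof (rule interval_integral_FTC_nonneg(1))
    show "DERIV (\<lambda>x. x powr a / a) x :> x powr (a - 1)" if "0 < ereal x" for x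
      using that assms by (auto intro!: derivative_eq_intros simp: powr_diff)
    show "(((\<lambda>x. x powr a / a) \<circ> real_of_ereal) \<longlongrightarrow> 0) (at_right 0)"
      unfolding zero_ereal_def ereal_tendsto_simps using assms by real_asymp
    show "(((\<lambda>x. x powr a / a) \<circ> real_of_ereal) \<longlongrightarrow> 1 / a) (at_left 1)"
      unfolding one_ereal_def ereal_tendsto_simps using assms
      by (auto intro!: tendsto_eq_intros)
  qed (auto intro!: continuous_intros)
  moreover have "einterval 0 1 = {0<..<1::real}"
    by (auto simp: einterval_def)
  ultimately show ?thesis by simp
qed

lemma set_integrable_powr_at_top:
  fixes r :: real
  assumes "r > 0"
  shows "set_integrable lborel {1<..} (\<lambda>x. x powr (- r - 1))"
proof -
  have "set_integrable lborel (einterval 1 \<infinity>) (\<lambda>x. x powr (- r - 1))"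
  proof (rule interval_integral_FTC_nonneg(1))
    show "DERIV (\<lambda>x. - (x powr (- r) / r)) x :> x powr (- r - 1)" if "1 < ereal x" for x
      using that assms by (auto intro!: derivative_eq_intros simp: powr_diff)
    show "(((\<lambda>x. - (x powr (- r) / r)) \<circ> real_of_ereal) \<longlongrightarrow> - 1 / r) (at_right 1)"
      unfolding one_ereal_def ereal_tendsto_simps using assms
      by (auto intro!: tendsto_eq_intros)
    show "(((\<lambda>x. - (x powr (- r) / r)) \<circ> real_of_ereal) \<longlongrightarrow> 0) (at_left \<infinity>)"
      unfolding ereal_tendsto_simps using assms by real_asymp
  qed (auto intro!: continuous_intros)
  moreover have "einterval 1 \<infinity> = {1::real<..}"
    by (auto simp: einterval_def)
  ultimately show ?thesis by simp
qed

text \<open>The antiderivative is \<open>- (1 + ln (1 + u)) powr (- g) / g\<close>, which vanishes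
  at infinity. This is the borderline tail for \<open>b = 0\<close>, where only the logarithm makes
  the mixing density proper.\<close>

lemma set_integrable_inverse_log_powr_at_top:
  fixes g :: real
  assumes "g > 0"
  shows "set_integrable lborel {1<..} (\<lambda>u. (1 + u) powr (-1) * (1 + ln (1 + u)) powr (- (1 + g)))"
    (is "set_integrable _ _ ?f")
proof -
  let ?F = "\<lambda>u::real. - ((1 + ln (1 + u)) powr (- g) / g)"
  have "set_integrable lborel (einterval 1 \<infinity>) ?f"
  proof (rule interval_integral_FTC_nonneg(1))
    fix x :: real assume "1 < ereal x"
    then have x: "x > 1" by simp
    then have l: "1 + ln (1 + x) > 0" by (simp add: add_pos_pos)
    show "DERIV ?F x :> ?f x"
      using x l assms
      by (auto intro!: derivative_eq_intros simp: powr_diff powr_minus divide_simps powr_add)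
    show "isCont ?f x"
      using x l by (intro continuous_intros) auto
  next
    have "(?F \<longlongrightarrow> ?F 1) (at_right 1)"
    proof -
      have "ln 2 > (0::real)" by simp
      then have "1 + ln 2 \<noteq> (0::real)" by linarith
      then have "isCont ?F 1"
        using assms by (intro continuous_intros) auto
      then show ?thesis
        by (simp add: isCont_def filterlim_at_split)
    qed
    then show "((?F \<circ> real_of_ereal) \<longlongrightarrow> ?F 1) (at_right 1)"
      unfolding one_ereal_def ereal_tendsto_simps .
    show "((?F \<circ> real_of_ereal) \<longlongrightarrow> 0) (at_left \<infinity>)"
      unfolding ereal_tendsto_simps using assms by real_asymp
  qed auto
  moreover have "einterval 1 \<infinity> = {1::real<..}"
    by (auto simp: einterval_def)
  ultimately show ?thesis by simp
qed

section \<open>The limiting inverse-gamma integral\<close>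

text \<open>The unnormalised inverse-gamma density with shape \<open>r\<close> and scale 1.\<close>

definition inv_gamma :: "real \<Rightarrow> real \<Rightarrow> real" where
  "inv_gamma r x = indicator {0<..} x * (x powr (- r - 1) * exp (- 1 / x))"

lemma inv_gamma_measurable [measurable]: "inv_gamma r \<in> borel_measurable borel"
  unfolding inv_gamma_def[abs_def] by measurable

lemma inv_gamma_nonneg: "inv_gamma r x \<ge> 0"
  by (simp add: inv_gamma_def)

text \<open>The right side is the maximum of the left, attained at \<open>z = s\<close>. The
  inequality \<open>ln w \<le> w - 1\<close> at \<open>w = z / s\<close> proves it.\<close>

lemma powr_times_exp_neg_le:
  fixes s z :: real
  assumes "s > 0" "z > 0"
  shows "z powr s * exp (- z) \<le> exp (s * ln s - s)"
proof -
  have "ln (z / s) \<le> z / s - 1"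
    using assms by (intro ln_le_minus_one) auto
  then have "s * ln (z / s) \<le> s * (z / s - 1)"
    using assms by (intro mult_left_mono) auto
  then have "s * ln z - z \<le> s * ln s - s"
    using assms by (simp add: ln_div algebra_simps)
  then show ?thesis
    using assms by (simp add: powr_def flip: exp_add)
qed

text \<open>On (0, 1] the function is bounded, by the preceding maximum taken at
  \<open>z = 1 / x\<close>. Beyond 1 the exponential factor is at most 1 and the power alone is
  integrable.\<close>

lemma integrable_inv_gamma:
  assumes r: "r > 0"
  shows "integrable lborel (inv_gamma r)"
proof -
  let ?C = "exp ((r + 1) * ln (r + 1) - (r + 1))"
  let ?w = "\<lambda>x::real. ?C * indicator {0..1} x + indicator {1<..} x * x powr (- r - 1)"
  have w: "integrable lborel ?w"
    using set_integrable_powr_at_top[OF r] unfolding set_integrable_def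
    by (intro Bochner_Integration.integrable_add integrable_mult_right) auto
  show ?thesis
  proof (rule Bochner_Integration.integrable_bound[OF w])
    show "AE x in lborel. norm (inv_gamma r x) \<le> norm (?w x)"
    proof (intro AE_I2)
      fix x :: real
      consider "x \<le> 0" | "0 < x" "x \<le> 1" | "x > 1" by linarith
      then show "norm (inv_gamma r x) \<le> norm (?w x)"
      proof cases
        case 2
        have "x powr (- r - 1) = (1 / x) powr (r + 1)"
          using 2 by (simp add: powr_divide powr_diff powr_minus powr_add divide_simps)
        then show ?thesis
          using powr_times_exp_neg_le[of "r + 1" "1 / x"] 2 r by (simp add: inv_gamma_def)
      next
        case 3
        then show ?thesis by (simp add: inv_gamma_def mult_left_le)
      qed (simp add: inv_gamma_def)
    qed
  qed simp
qed

text \<open>A vanishing integral would force the function to be zero almost everywhere, yet it is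
  positive on (0, 1). Positivity later permits division by the limit.\<close>

lemma integral_inv_gamma_pos:
  assumes "r > 0"
  shows "(\<integral>x. inv_gamma r x \<partial>lborel) > 0"
proof -
  have "(\<integral>x. inv_gamma r x \<partial>lborel) \<noteq> 0"
  proof
    assume "(\<integral>x. inv_gamma r x \<partial>lborel) = 0"
    then have "AE x in lborel. inv_gamma r x = 0"
      using integral_nonneg_eq_0_iff_AE[OF integrable_inv_gamma[OF assms]] inv_gamma_nonneg
      by simp
    then have "AE x in lborel. x \<notin> {0<..<1::real}"
      by eventually_elim (auto simp: inv_gamma_def)
    then have "emeasure lborel {0<..<1::real} = 0"
      by (subst (asm) AE_iff_measurable[of "{0<..<1}"]) auto
    then show False by simp
  qed
  moreover have "(\<integral>x. inv_gamma r x \<partial>lborel) \<ge> 0"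
    by (simp add: inv_gamma_nonneg)
  ultimately show ?thesis by linarith
qed

text \<open>Integration by parts: the difference of the two integrands is the derivative of
  \<open>x powr (- r) * exp (- 1 / x)\<close>, which vanishes at 0 because of the exponential and at
  infinity because \<open>r > 0\<close>.\<close>

lemma integral_inv_gamma_plus_one:
  assumes r: "r > 0"
  shows "(\<integral>x. inv_gamma (r + 1) x \<partial>lborel) = r * (\<integral>x. inv_gamma r x \<partial>lborel)"
proof -
  let ?F = "\<lambda>x::real. x powr (- r) * exp (- 1 / x)"
  let ?f = "\<lambda>x::real. x powr (- (r + 1) - 1) * exp (- 1 / x) - r * (x powr (- r - 1) * exp (- 1 / x))"
  have e: "einterval 0 \<infinity> = {0::real<..}"
    by (auto simp: einterval_def)
  have f: "indicator {0<..} x * ?f x = inv_gamma (r + 1) x - r * inv_gamma r x" for x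
    by (simp add: inv_gamma_def algebra_simps)
  have i: "integrable lborel (inv_gamma (r + 1))" "integrable lborel (inv_gamma r)"
    using r by (auto intro: integrable_inv_gamma)
  have "(LBINT x=0..\<infinity>. ?f x) = 0 - 0"
  proof (rule interval_integral_FTC_integrable)
    fix x :: real assume "0 < ereal x"
    then have x: "x > 0" by simp
    show "(?F has_vector_derivative ?f x) (at x)"
      unfolding has_real_derivative_iff_has_vector_derivative[symmetric]
      using x by (auto intro!: derivative_eq_intros
        simp: powr_diff powr_minus powr_add field_simps power2_eq_square)
    show "isCont ?f x"
      using x by (intro continuous_intros) auto
  next
    show "set_integrable lborel (einterval 0 \<infinity>) ?f"
      unfolding set_integrable_def e real_scaleR_def f using i by auto
    show "((?F \<circ> real_of_ereal) \<longlongrightarrow> 0) (at_right 0)"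
      unfolding zero_ereal_def ereal_tendsto_simps using r by real_asymp
    show "((?F \<circ> real_of_ereal) \<longlongrightarrow> 0) (at_left \<infinity>)"
      unfolding ereal_tendsto_simps using r by real_asymp
  qed auto
  then have "(\<integral>x. inv_gamma (r + 1) x - r * inv_gamma r x \<partial>lborel) = 0"
    unfolding interval_lebesgue_integral_def set_lebesgue_integral_def e real_scaleR_def f
    by simp
  then show ?thesis
    using i by simp
qed

section \<open>Propriety of the mixing density\<close>

text \<open>The sum covers both signs of \<open>p\<close>. It is applied with
  \<open>p = a - 1\<close>, whose sign is not fixed.\<close>

lemma powr_le_on_half_one:
  fixes x p :: real
  assumes "1 / 2 \<le> x" "x \<le> 1"
  shows "x powr p \<le> 1 + 2 powr (- p)"
proof (cases "p \<ge> 0")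
  case True
  then have "x powr p \<le> 1"
    using assms by (intro powr_le1) auto
  then show ?thesis
    by (simp add: add_increasing2)
next
  case False
  then have "x powr p \<le> (1 / 2) powr p"
    using assms by (intro powr_mono2') auto
  moreover have "(1 / 2) powr p = 2 powr (- p)"
    by (simp add: powr_divide powr_minus divide_simps)
  ultimately show ?thesis by linarith
qed

lemma mixing_kernel_nonneg: "mixing_kernel a b \<gamma> u \<ge> 0"
  by (simp add: mixing_kernel_def)

lemma mixing_kernel_measurable [measurable]: "mixing_kernel a b \<gamma> \<in> borel_measurable borel"
  unfolding mixing_kernel_def[abs_def] by measurable

lemma powr_le_one_if_nonpos:
  fixes x p :: real
  assumes "x \<ge> 1" "p \<le> 0"
  shows "x powr p \<le> 1"
  using powr_mono[of p 0 x] assms by auto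

text \<open>Near 0 the factor \<open>u powr (a - 1)\<close> is integrable since
  \<open>a > 0\<close>. At infinity the kernel behaves like \<open>(1 + u) powr (- b - 1)\<close>
  times the log factor, so convergence comes from the power if \<open>b > 0\<close> and from the
  logarithm if \<open>b = 0\<close>. Both cases of the theorem fit these hypotheses.\<close>

lemma integrable_mixing_kernel:
  assumes a: "a > 0" and b: "b \<ge> 0" and g: "\<gamma> \<ge> -1" and "b > 0 \<or> \<gamma> > 0"
  shows "integrable lborel (mixing_kernel a b \<gamma>)"
proof -
  define L :: "real \<Rightarrow> real" where "L u = (1 + ln (1 + u)) powr (- (1 + \<gamma>))" for u
  have L: "0 \<le> L u" "L u \<le> 1" if "u > 0" for u
    using that g ln_ge_zero[of "1 + u"] by (auto simp: L_def intro!: powr_le_one_if_nonpos)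
  obtain h :: "real \<Rightarrow> real" where h: "set_integrable lborel {1<..} h"
    "\<And>u. u > 1 \<Longrightarrow> (1 + u) powr (- b - 1) * L u \<le> h u"
  proof (cases "b > 0")
    case True
    show ?thesis
    proof (rule that)
      show "set_integrable lborel {1<..} (\<lambda>x. x powr (- b - 1))"
        by (rule set_integrable_powr_at_top[OF True])
      fix u :: real assume u: "u > 1"
      have "(1 + u) powr (- b - 1) * L u \<le> u powr (- b - 1) * 1"
        using u b L[of u] by (intro mult_mono powr_mono2') auto
      then show "(1 + u) powr (- b - 1) * L u \<le> u powr (- b - 1)" by simp
    qed
  next
    case False
    with assms have g: "\<gamma> > 0" by auto
    show ?thesis
    proof (rule that)
      show "set_integrable lborel {1<..} (\<lambda>u. (1 + u) powr (-1) * (1 + ln (1 + u)) powr (- (1 + \<gamma>)))"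
        by (rule set_integrable_inverse_log_powr_at_top[OF g])
      fix u :: real assume u: "u > 1"
      show "(1 + u) powr (- b - 1) * L u \<le> (1 + u) powr (-1) * (1 + ln (1 + u)) powr (- (1 + \<gamma>))"
        using u b unfolding L_def by (intro mult_right_mono powr_mono) auto
    qed
  qed
  define C where "C = 1 + 2 powr (- (a - 1))"
  have C: "C \<ge> 0" by (simp add: C_def)
  let ?w = "\<lambda>u. indicator {0<..<1} u * u powr (a - 1) + C * (indicator {1<..} u * h u)"
  have w: "integrable lborel ?w"
    using set_integrable_powr_at_0[OF a] h(1) unfolding set_integrable_def real_scaleR_def
    by (intro Bochner_Integration.integrable_add integrable_mult_right) auto
  show ?thesis
  proof (rule Bochner_Integration.integrable_bound[OF w])
    \<comment> \<open>The majorant vanishes at \<open>u = 1\<close>, so that null point has to be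
      left out.\<close>
    show "AE u in lborel. norm (mixing_kernel a b \<gamma> u) \<le> norm (?w u)"
      using AE_lborel_singleton[of "1::real"]
    proof eventually_elim
      fix u :: real assume "u \<noteq> 1"
      then consider "u \<le> 0" | "0 < u" "u < 1" | "u > 1" by linarith
      then show "norm (mixing_kernel a b \<gamma> u) \<le> norm (?w u)"
      proof cases
        case 2
        have "mixing_kernel a b \<gamma> u = u powr (a - 1) * (1 + u) powr (- (a + b)) * L u"
          using 2 by (simp add: mixing_kernel_def L_def)
        also have "\<dots> \<le> u powr (a - 1) * 1 * 1"
          using 2 a b L[of u] by (intro mult_mono powr_le_one_if_nonpos) auto
        finally show ?thesis
          using 2 mixing_kernel_nonneg[of a b \<gamma> u] by simp
      next
        case 3
        \<comment> \<open>The base \<open>u / (1 + u)\<close> lies in [1/2, 1] for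
          \<open>u > 1\<close>, so its power is at most \<open>C\<close> whatever the sign of
          \<open>a - 1\<close>.\<close>
        have "u powr (a - 1) * (1 + u) powr (- (a + b))
            = (u / (1 + u)) powr (a - 1) * (1 + u) powr (- b - 1)"
          using 3 by (simp add: powr_divide powr_diff powr_minus powr_add divide_simps)
        then have "mixing_kernel a b \<gamma> u
            = (u / (1 + u)) powr (a - 1) * ((1 + u) powr (- b - 1) * L u)"
          using 3 by (simp add: mixing_kernel_def L_def mult_ac)
        also have "\<dots> \<le> C * h u"
          unfolding C_def using 3 h(2)[of u] L[of u]
          by (intro mult_mono powr_le_on_half_one) (auto simp: divide_simps)
        finally have "mixing_kernel a b \<gamma> u \<le> C * h u" .
        then show ?thesis
          using 3 mixing_kernel_nonneg[of a b \<gamma> u] by simp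
      qed (simp add: mixing_kernel_def)
    qed
  qed simp
qed

section \<open>Asymptotics of the Laplace-type integrals\<close>

text \<open>This is \<open>J s t\<close>. At \<open>t = y^2 / 2\<close>, the case
  \<open>s = 1/2\<close> is the marginal density of \<open>y\<close> up to a constant;
  \<open>s = 3/2\<close> and \<open>s = 5/2\<close> insert the factors \<kappa> and
  \<kappa>^2.\<close>

definition kernel_laplace :: "real \<Rightarrow> real \<Rightarrow> real \<Rightarrow> real \<Rightarrow> real \<Rightarrow> real" where
  "kernel_laplace a b \<gamma> s t =
     (\<integral>u. mixing_kernel a b \<gamma> u * ((1 + u) powr (- s) * exp (- t / (1 + u))) \<partial>lborel)"

lemma integrable_kernel_laplace:
  assumes "integrable lborel (mixing_kernel a b \<gamma>)" "s \<ge> 0" "t \<ge> 0"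
  shows "integrable lborel (\<lambda>u. mixing_kernel a b \<gamma> u * ((1 + u) powr (- s) * exp (- t / (1 + u))))"
proof (rule Bochner_Integration.integrable_bound[OF assms(1)])
  show "AE u in lborel. norm (mixing_kernel a b \<gamma> u * ((1 + u) powr (- s) * exp (- t / (1 + u))))
      \<le> norm (mixing_kernel a b \<gamma> u)"
  proof (intro AE_I2)
    fix u :: real
    show "norm (mixing_kernel a b \<gamma> u * ((1 + u) powr (- s) * exp (- t / (1 + u))))
      \<le> norm (mixing_kernel a b \<gamma> u)"
    proof (cases "u > 0")
      case True
      have "(1 + u) powr (- s) * exp (- t / (1 + u)) \<le> 1 * 1"
        using True assms by (intro mult_mono powr_le_one_if_nonpos) auto
      then show ?thesis
        by (simp add: abs_mult mult_left_le)
    qed (simp add: mixing_kernel_def)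
  qed
qed measurable

text \<open>A bound uniform in \<open>t\<close>, as dominated convergence requires. For
  \<open>x < 1\<close> it follows from \<open>- ln x \<le> 1 / x - 1\<close>, which gives
  \<open>1 + ln t \<le> 1 / x + ln (t * x)\<close>.\<close>

lemma log_ratio_le:
  fixes t x :: real
  assumes t: "t \<ge> 1" and x: "x > 0" "t * x > 1"
  shows "(1 + ln t) / (1 + ln (t * x)) \<le> max 1 (1 / x)"
proof -
  have p: "ln (t * x) > 0" using x by simp
  have e: "ln (t * x) = ln t + ln x" using t x by (simp add: ln_mult)
  show ?thesis
  proof (cases "x \<ge> 1")
    case True
    then have "ln x \<ge> 0" by simp
    then have "(1 + ln t) / (1 + ln (t * x)) \<le> 1"
      using p e by simp
    then show ?thesis by simp
  next
    case False
    have l: "- ln x \<le> 1 / x - 1"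
      using ln_le_minus_one[of "1 / x"] x by (simp add: ln_div)
    have "0 \<le> (1 / x - 1) * ln (t * x)"
      using False x p by (intro mult_nonneg_nonneg) auto
    then have "1 + ln t \<le> 1 / x * (1 + ln (t * x))"
      using l e by (simp add: algebra_simps)
    then show ?thesis
      using p by (simp add: pos_divide_le_eq le_max_iff_disj)
  qed
qed

lemma powr_max_one_le:
  fixes x c :: real
  assumes "x > 0" "c \<ge> 0"
  shows "max 1 (1 / x) powr c \<le> 1 + x powr (- c)"
  using assms by (auto simp: max_def powr_divide powr_minus divide_simps)

text \<open>The cutoff \<open>u > 1\<close> becomes \<open>t * x > 2\<close> after the substitution.
  This keeps \<open>1 - 1 / (t * x)\<close> above 1/2, so its power is bounded even for
  \<open>a < 1\<close>, and keeps \<open>ln (t * x)\<close> positive.\<close>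

lemma kernel_laplace_far_tendsto:
  assumes bs: "b + s > 0" and g: "\<gamma> \<ge> -1"
  shows "((\<lambda>t. t powr (b + s) * (1 + ln t) powr (1 + \<gamma>) *
      (\<integral>u. indicator {1<..} u * (mixing_kernel a b \<gamma> u * ((1 + u) powr (- s) * exp (- t / (1 + u)))) \<partial>lborel))
    \<longlongrightarrow> (\<integral>x. inv_gamma (b + s) x \<partial>lborel)) at_top"
proof -
  define q where "q = b + s"
  define c where "c = 1 + \<gamma>"
  define C where "C = 1 + 2 powr (- (a - 1))"
  \<comment> \<open>The normalised integrand after \<open>1 + u = t * x\<close>, Jacobian included.
    Both factors in front of \<open>inv_gamma q x\<close> tend to 1.\<close>
  define S :: "real \<Rightarrow> real \<Rightarrow> real" where
    "S t x = indicator {1<..} (t * x - 1) *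
       ((1 - 1 / (t * x)) powr (a - 1) * ((1 + ln t) / (1 + ln (t * x))) powr c * inv_gamma q x)"
    for t x
  \<comment> \<open>The log ratio costs at most \<open>1 + x powr (- c)\<close>, and multiplying by
    \<open>x powr (- c)\<close> turns \<open>inv_gamma q\<close> into
    \<open>inv_gamma (q + c)\<close>.\<close>
  define w where "w x = C * (inv_gamma q x + inv_gamma (q + c) x)" for x
  have c: "c \<ge> 0" and q: "q > 0" using assms by (auto simp: c_def q_def)
  have S_meas [measurable]: "S t \<in> borel_measurable borel" for t
    unfolding S_def[abs_def] by measurable
  have "((\<lambda>t. \<integral>x. S t x \<partial>lborel) \<longlongrightarrow> (\<integral>x. inv_gamma q x \<partial>lborel)) at_top"
  proof (rule integral_dominated_convergence_at_top)
    show "integrable lborel w"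
      unfolding w_def using c q integrable_inv_gamma[of q] integrable_inv_gamma[of "q + c"] by auto
    show "AE x in lborel. ((\<lambda>t. S t x) \<longlongrightarrow> inv_gamma q x) at_top"
    proof (intro AE_I2)
      fix x :: real
      show "((\<lambda>t. S t x) \<longlongrightarrow> inv_gamma q x) at_top"
      proof (cases "x > 0")
        case False
        then have "inv_gamma q x = 0" by (simp add: inv_gamma_def)
        then show ?thesis by (simp add: S_def)
      next
        case True
        have "((\<lambda>t. (1 - 1 / (t * x)) powr (a - 1)) \<longlongrightarrow> 1) at_top"
          using True by real_asymp
        moreover have "((\<lambda>t. ((1 + ln t) / (1 + ln (t * x))) powr c) \<longlongrightarrow> 1) at_top"
          using True by real_asymp
        ultimately have "((\<lambda>t. (1 - 1 / (t * x)) powr (a - 1) *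
            ((1 + ln t) / (1 + ln (t * x))) powr c * inv_gamma q x) \<longlongrightarrow> 1 * 1 * inv_gamma q x) at_top"
          by (intro tendsto_intros)
        moreover have "\<forall>\<^sub>F t in at_top. (1 - 1 / (t * x)) powr (a - 1) *
            ((1 + ln t) / (1 + ln (t * x))) powr c * inv_gamma q x = S t x"
          using eventually_gt_at_top[of "2 / x"]
          by eventually_elim (use True in \<open>simp add: S_def divide_simps\<close>)
        ultimately show ?thesis
          by (simp add: tendsto_cong)
      qed
    qed
    show "\<forall>\<^sub>F t in at_top. AE x in lborel. norm (S t x) \<le> w x"
      using eventually_ge_at_top[of 1]
    proof eventually_elim
      fix t :: real assume t: "t \<ge> 1"
      show "AE x in lborel. norm (S t x) \<le> w x"
      proof (intro AE_I2)
        fix x :: real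
        have w0: "w x \<ge> 0"
          by (simp add: w_def C_def inv_gamma_nonneg)
        show "norm (S t x) \<le> w x"
        proof (cases "t * x > 2")
          case False
          then show ?thesis using w0 by (simp add: S_def)
        next
          case True
          then have x: "x > 0"
            using t zero_less_mult_pos[of t x] by linarith
          have 1: "(1 - 1 / (t * x)) powr (a - 1) \<le> C"
            unfolding C_def using True by (intro powr_le_on_half_one) (auto simp: field_simps)
          have l: "1 + ln (t * x) > 0"
            using True by (intro add_pos_pos) auto
          have r: "(1 + ln t) / (1 + ln (t * x)) \<ge> 0"
            using t l by (intro divide_nonneg_pos) auto
          have "((1 + ln t) / (1 + ln (t * x))) powr c \<le> max 1 (1 / x) powr c"
            using log_ratio_le[of t x] t x True r c by (intro powr_mono2) auto
          also have "\<dots> \<le> 1 + x powr (- c)"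
            using x c by (rule powr_max_one_le)
          finally have 2: "((1 + ln t) / (1 + ln (t * x))) powr c \<le> 1 + x powr (- c)" .
          have "norm (S t x) = (1 - 1 / (t * x)) powr (a - 1) * ((1 + ln t) / (1 + ln (t * x))) powr c * inv_gamma q x"
            using True by (simp add: S_def abs_mult inv_gamma_nonneg)
          also have "\<dots> \<le> C * (1 + x powr (- c)) * inv_gamma q x"
            using 1 2 by (intro mult_mono) (auto simp: inv_gamma_nonneg C_def)
          also have "\<dots> = w x"
            using x by (simp add: w_def inv_gamma_def powr_diff powr_minus powr_add divide_simps)
              (simp add: algebra_simps)
          finally show ?thesis .
        qed
      qed
    qed
  qed measurable
  moreover have "\<forall>\<^sub>F t in at_top. (\<integral>x. S t x \<partial>lborel) = t powr (b + s) * (1 + ln t) powr (1 + \<gamma>) *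
      (\<integral>u. indicator {1<..} u * (mixing_kernel a b \<gamma> u * ((1 + u) powr (- s) * exp (- t / (1 + u)))) \<partial>lborel)"
    using eventually_ge_at_top[of 1]
  proof eventually_elim
    fix t :: real assume t: "t \<ge> 1"
    let ?f = "\<lambda>u. indicator {1<..} u * (mixing_kernel a b \<gamma> u * ((1 + u) powr (- s) * exp (- t / (1 + u))))"
    have "(\<integral>u. ?f u \<partial>lborel) = \<bar>t\<bar> *\<^sub>R (\<integral>x. ?f (- 1 + t * x) \<partial>lborel)"
      using t by (intro lborel_integral_real_affine) auto
    then have "t powr q * (1 + ln t) powr c * (\<integral>u. ?f u \<partial>lborel)
        = (\<integral>x. (t powr q * (1 + ln t) powr c * t) * ?f (- 1 + t * x) \<partial>lborel)"
      using t by simp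
    also have "\<dots> = (\<integral>x. S t x \<partial>lborel)"
    proof (rule Bochner_Integration.integral_cong)
      fix x :: real
      show "(t powr q * (1 + ln t) powr c * t) * ?f (- 1 + t * x) = S t x"
      proof (cases "t * x > 2")
        case False
        then show ?thesis by (simp add: S_def)
      next
        case True
        then have x: "x > 0"
          using t zero_less_mult_pos[of t x] by linarith
        have l: "1 + ln (t * x) > 0"
          using True by (intro add_pos_pos) auto
        have tl: "1 + ln t > 0"
          using t by (intro add_pos_nonneg) auto
        have f: "?f (- 1 + t * x) = (t * x - 1) powr (a - 1) * (t * x) powr (- (a + b)) *
           (1 + ln (t * x)) powr (- c) * ((t * x) powr (- s) * exp (- t / (t * x)))"
          using True by (simp add: mixing_kernel_def c_def)
        have A: "(t * x - 1) powr (a - 1) = (1 - 1 / (t * x)) powr (a - 1) * (t * x) powr (a - 1)"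
        proof -
          have "t * x - 1 = (1 - 1 / (t * x)) * (t * x)"
            using t x by (simp add: left_diff_distrib)
          then show ?thesis
            using True by (simp only: powr_mult)
        qed
        \<comment> \<open>Here \<open>a\<close> cancels from the exponent, so the limit does not
          depend on it. Next, \<open>t powr q\<close> and the Jacobian \<open>t\<close> remove the
          remaining power of \<open>t\<close>.\<close>
        have B: "(t * x) powr (a - 1) * (t * x) powr (- (a + b)) * (t * x) powr (- s)
            = (t * x) powr (- q - 1)"
        proof -
          have "a - 1 + - (a + b) + - s = - q - 1" by (simp add: q_def)
          then show ?thesis by (simp only: powr_add[symmetric])
        qed
        have D: "(t * x) powr (- q - 1) * (t powr q * t) = x powr (- q - 1)"
          using t x by (simp add: powr_mult powr_diff powr_minus divide_simps)
        have E: "((1 + ln t) / (1 + ln (t * x))) powr c = (1 + ln t) powr c * (1 + ln (t * x)) powr (- c)"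
          using l tl by (simp add: powr_divide powr_minus divide_simps)
        have "(t powr q * (1 + ln t) powr c * t) * ?f (- 1 + t * x) =
          (1 - 1 / (t * x)) powr (a - 1) * ((1 + ln t) powr c * (1 + ln (t * x)) powr (- c)) *
          (((t * x) powr (a - 1) * (t * x) powr (- (a + b)) * (t * x) powr (- s)) * (t powr q * t)
            * exp (- t / (t * x)))"
          unfolding f A by (simp only: mult_ac)
        also have "\<dots> = S t x"
          unfolding B D E[symmetric] using True t x by (simp add: S_def inv_gamma_def)
        finally show ?thesis .
      qed
    qed simp
    finally show "(\<integral>x. S t x \<partial>lborel) = t powr (b + s) * (1 + ln t) powr (1 + \<gamma>) * (\<integral>u. ?f u \<partial>lborel)"
      by (simp add: q_def c_def)
  qed
  ultimately show ?thesis
    by (simp add: tendsto_cong q_def)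
qed

text \<open>For \<open>0 < u \<le> 1\<close> one has \<open>1 / (1 + u) \<ge> 1/2\<close>, so the
  integral is at most a constant times \<open>exp (- t / 2)\<close>, which beats every power of
  \<open>t\<close> and of \<open>1 + ln t\<close>.\<close>

lemma kernel_laplace_near_tendsto:
  assumes k: "integrable lborel (mixing_kernel a b \<gamma>)" and s: "s \<ge> 0"
  shows "((\<lambda>t. t powr p * (1 + ln t) powr c *
      (\<integral>u. indicator {..1} u * (mixing_kernel a b \<gamma> u * ((1 + u) powr (- s) * exp (- t / (1 + u)))) \<partial>lborel))
    \<longlongrightarrow> 0) at_top" (is "((\<lambda>t. _ * _ * ?I t) \<longlongrightarrow> 0) _")
proof -
  define Z where "Z = (\<integral>u. mixing_kernel a b \<gamma> u \<partial>lborel)"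
  have "\<forall>\<^sub>F t in at_top. norm (t powr p * (1 + ln t) powr c * ?I t)
      \<le> t powr p * (1 + ln t) powr c * (Z * exp (- t / 2))"
    using eventually_ge_at_top[of 1]
  proof eventually_elim
    fix t :: real assume t: "t \<ge> 1"
    have "norm (?I t) \<le> (\<integral>u. mixing_kernel a b \<gamma> u * exp (- t / 2) \<partial>lborel)"
    proof (rule Bochner_Integration.integral_norm_bound_integral)
      have "integrable lborel (\<lambda>u. mixing_kernel a b \<gamma> u * ((1 + u) powr (- s) * exp (- t / (1 + u))))"
        using k s t by (intro integrable_kernel_laplace) auto
      from integrable_real_mult_indicator[OF _ this, of "{..1}"]
      show "integrable lborel (\<lambda>u. indicator {..1} u *
          (mixing_kernel a b \<gamma> u * ((1 + u) powr (- s) * exp (- t / (1 + u)))))"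
        by (simp add: mult_ac)
      show "integrable lborel (\<lambda>u. mixing_kernel a b \<gamma> u * exp (- t / 2))"
        using k by simp
      fix u :: real
      show "norm (indicator {..1} u * (mixing_kernel a b \<gamma> u * ((1 + u) powr (- s) * exp (- t / (1 + u)))))
          \<le> mixing_kernel a b \<gamma> u * exp (- t / 2)"
      proof (cases "0 < u \<and> u \<le> 1")
        case True
        then have "(1 + u) powr (- s) * exp (- t / (1 + u)) \<le> 1 * exp (- t / 2)"
          using s t by (intro mult_mono powr_le_one_if_nonpos) (auto simp: field_simps)
        then show ?thesis
          using True by (auto simp: abs_mult mixing_kernel_nonneg intro!: mult_left_mono)
      next
        case False
        then consider "u \<le> 0" | "u > 1" by linarith
        then show ?thesis
          by cases (auto simp: mixing_kernel_def)
      qed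
    qed
    also have "\<dots> = Z * exp (- t / 2)"
      by (simp add: Z_def)
    finally show "norm (t powr p * (1 + ln t) powr c * ?I t)
        \<le> t powr p * (1 + ln t) powr c * (Z * exp (- t / 2))"
      by (simp add: abs_mult mult_left_mono)
  qed
  moreover have "((\<lambda>t. t powr p * (1 + ln t) powr c * (Z * exp (- t / 2))) \<longlongrightarrow> 0) at_top"
    by real_asymp
  ultimately show ?thesis
    by (rule Lim_null_comparison)
qed

lemma kernel_laplace_tendsto:
  assumes k: "integrable lborel (mixing_kernel a b \<gamma>)"
    and "b + s > 0" "s \<ge> 0" "\<gamma> \<ge> -1"
  shows "((\<lambda>t. t powr (b + s) * (1 + ln t) powr (1 + \<gamma>) * kernel_laplace a b \<gamma> s t)
    \<longlongrightarrow> (\<integral>x. inv_gamma (b + s) x \<partial>lborel)) at_top"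
proof -
  let ?f = "\<lambda>t u. mixing_kernel a b \<gamma> u * ((1 + u) powr (- s) * exp (- t / (1 + u)))"
  have "\<forall>\<^sub>F t in at_top. kernel_laplace a b \<gamma> s t =
      (\<integral>u. indicator {1<..} u * ?f t u \<partial>lborel) + (\<integral>u. indicator {..1} u * ?f t u \<partial>lborel)"
    using eventually_ge_at_top[of 0]
  proof eventually_elim
    fix t :: real assume t: "t \<ge> 0"
    have i: "integrable lborel (?f t)"
      using assms t by (intro integrable_kernel_laplace) auto
    have ind: "integrable lborel (\<lambda>u. indicator A u * ?f t u)" if "A \<in> sets borel" for A
      using integrable_real_mult_indicator[OF _ i, of A] that by (simp add: mult_ac)
    have "kernel_laplace a b \<gamma> s t =
        (\<integral>u. indicator {1<..} u * ?f t u + indicator {..1} u * ?f t u \<partial>lborel)"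
      unfolding kernel_laplace_def
      by (intro Bochner_Integration.integral_cong) (auto simp: indicator_def)
    then show "kernel_laplace a b \<gamma> s t =
      (\<integral>u. indicator {1<..} u * ?f t u \<partial>lborel) + (\<integral>u. indicator {..1} u * ?f t u \<partial>lborel)"
      using ind by simp
  qed
  then have "\<forall>\<^sub>F t in at_top. t powr (b + s) * (1 + ln t) powr (1 + \<gamma>) * kernel_laplace a b \<gamma> s t =
      t powr (b + s) * (1 + ln t) powr (1 + \<gamma>) * (\<integral>u. indicator {1<..} u * ?f t u \<partial>lborel)
      + t powr (b + s) * (1 + ln t) powr (1 + \<gamma>) * (\<integral>u. indicator {..1} u * ?f t u \<partial>lborel)"
    by eventually_elim (simp add: distrib_left)
  moreover have "((\<lambda>t. t powr (b + s) * (1 + ln t) powr (1 + \<gamma>) * (\<integral>u. indicator {1<..} u * ?f t u \<partial>lborel)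
      + t powr (b + s) * (1 + ln t) powr (1 + \<gamma>) * (\<integral>u. indicator {..1} u * ?f t u \<partial>lborel))
      \<longlongrightarrow> (\<integral>x. inv_gamma (b + s) x \<partial>lborel) + 0) at_top"
    using assms by (intro tendsto_add kernel_laplace_far_tendsto kernel_laplace_near_tendsto) auto
  ultimately show ?thesis
    by (simp add: tendsto_cong)
qed

section \<open>Reduction of the posterior mean squared error to these integrals\<close>

text \<open>Completing the square in \<theta> factors the joint density given \<open>u\<close> into
  the marginal density of \<open>y\<close> and the conditional posterior density of
  \<theta>.\<close>

lemma normal_density_mult:
  assumes u: "u > 0"
  shows "normal_density 0 (sqrt u) \<theta> * normal_density \<theta> 1 y
    = normal_density 0 (sqrt (1 + u)) y * normal_density (u * y / (1 + u)) (sqrt (u / (1 + u))) \<theta>"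
proof -
  have s: "sqrt (2 * pi * u) * sqrt (2 * pi) = sqrt (2 * pi * (1 + u)) * sqrt (2 * pi * (u / (1 + u)))"
    using u unfolding real_sqrt_mult[symmetric] by simp
  have e: "- \<theta>\<^sup>2 / (2 * u) + - (y - \<theta>)\<^sup>2 / 2
      = - y\<^sup>2 / (2 * (1 + u)) + - (\<theta> - u * y / (1 + u))\<^sup>2 / (2 * (u / (1 + u)))"
    using u by (simp add: divide_simps) (simp add: power2_eq_square algebra_simps)
  have "normal_density 0 (sqrt u) \<theta> * normal_density \<theta> 1 y
    = 1 / (sqrt (2 * pi * u) * sqrt (2 * pi)) * exp (- \<theta>\<^sup>2 / (2 * u) + - (y - \<theta>)\<^sup>2 / 2)"
    using u unfolding normal_density_def exp_add by simp
  also have "\<dots> = normal_density 0 (sqrt (1 + u)) y * normal_density (u * y / (1 + u)) (sqrt (u / (1 + u))) \<theta>"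
    using u unfolding normal_density_def exp_add s e by simp
  finally show ?thesis .
qed

lemma nn_integral_normal_density:
  assumes "\<sigma> > 0"
  shows "(\<integral>\<^sup>+x. ennreal (normal_density \<mu> \<sigma> x) \<partial>lborel) = 1"
  using assms by (subst nn_integral_eq_integral) auto

text \<open>Expanding \<open>(x - y)^2\<close> around the mean \<mu> gives variance plus squared
  bias; the cross term is a vanishing odd moment.\<close>

lemma nn_integral_normal_density_sq_dist:
  assumes s: "\<sigma> > 0"
  shows "(\<integral>\<^sup>+x. ennreal (normal_density \<mu> \<sigma> x * (x - y)\<^sup>2) \<partial>lborel) = ennreal (\<sigma>\<^sup>2 + (\<mu> - y)\<^sup>2)"
proof -
  let ?N = "normal_density \<mu> \<sigma>"
  have 0: "has_bochner_integral lborel ?N 1"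
    using s by (simp add: has_bochner_integral_iff)
  have 1: "has_bochner_integral lborel (\<lambda>x. ?N x * (x - \<mu>)) 0"
    using normal_moment_odd[OF s, of \<mu> 0] by simp
  have 2: "has_bochner_integral lborel (\<lambda>x. ?N x * (x - \<mu>)\<^sup>2) (\<sigma>\<^sup>2)"
    using normal_moment_even[OF s, of \<mu> 1] by (simp add: numeral_2_eq_2)
  have "has_bochner_integral lborel
      (\<lambda>x. ?N x * (x - \<mu>)\<^sup>2 + (?N x * (x - \<mu>)) * (2 * (\<mu> - y)) + ?N x * (\<mu> - y)\<^sup>2)
      (\<sigma>\<^sup>2 + 0 * (2 * (\<mu> - y)) + 1 * (\<mu> - y)\<^sup>2)"
    by (intro has_bochner_integral_add has_bochner_integral_mult_left 0 1 2)
  also have "(\<lambda>x. ?N x * (x - \<mu>)\<^sup>2 + (?N x * (x - \<mu>)) * (2 * (\<mu> - y)) + ?N x * (\<mu> - y)\<^sup>2)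
      = (\<lambda>x. ?N x * (x - y)\<^sup>2)"
    by (intro ext) (simp add: power2_eq_square algebra_simps)
  finally have "has_bochner_integral lborel (\<lambda>x. ?N x * (x - y)\<^sup>2) (\<sigma>\<^sup>2 + (\<mu> - y)\<^sup>2)"
    by simp
  then show ?thesis
    by (subst nn_integral_eq_integral) (auto simp: has_bochner_integral_iff)
qed

lemma measurable_normal_density_mean [measurable]:
  "(\<lambda>\<theta>. normal_density \<theta> 1 y) \<in> borel_measurable borel"
  unfolding normal_density_def by measurable

lemma measurable_normal_density_pair [measurable]:
  "(\<lambda>(\<theta>, u). normal_density 0 (sqrt u) \<theta>) \<in> borel_measurable (borel \<Otimes>\<^sub>M borel)"
  unfolding normal_density_def by measurable

text \<open>Tonelli's theorem. Working in \<open>ennreal\<close> also covers points where the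
  mixture density is infinite.\<close>

lemma nn_integral_normal_scale_mixture:
  assumes [measurable]: "k \<in> borel_measurable borel" "h \<in> borel_measurable borel"
  shows "(\<integral>\<^sup>+\<theta>. h \<theta> \<partial>normal_scale_mixture (density lborel k))
    = (\<integral>\<^sup>+u. k u * (\<integral>\<^sup>+\<theta>. ennreal (normal_density 0 (sqrt u) \<theta>) * h \<theta> \<partial>lborel) \<partial>lborel)"
proof -
  have "normal_scale_mixture (density lborel k)
      = density lborel (\<lambda>\<theta>. \<integral>\<^sup>+u. k u * ennreal (normal_density 0 (sqrt u) \<theta>) \<partial>lborel)"
    unfolding normal_scale_mixture_def by (subst nn_integral_density) auto
  then have "(\<integral>\<^sup>+\<theta>. h \<theta> \<partial>normal_scale_mixture (density lborel k))
    = (\<integral>\<^sup>+\<theta>. (\<integral>\<^sup>+u. k u * ennreal (normal_density 0 (sqrt u) \<theta>) \<partial>lborel) * h \<theta> \<partial>lborel)"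
    by (simp add: nn_integral_density)
  also have "\<dots> = (\<integral>\<^sup>+\<theta>. (\<integral>\<^sup>+u. k u * ennreal (normal_density 0 (sqrt u) \<theta>) * h \<theta> \<partial>lborel) \<partial>lborel)"
    by (intro nn_integral_cong nn_integral_multc[symmetric]) auto
  also have "\<dots> = (\<integral>\<^sup>+u. (\<integral>\<^sup>+\<theta>. k u * ennreal (normal_density 0 (sqrt u) \<theta>) * h \<theta> \<partial>lborel) \<partial>lborel)"
    by (rule lborel_pair.Fubini'[symmetric]) (simp add: split_beta)
  also have "\<dots> = (\<integral>\<^sup>+u. k u * (\<integral>\<^sup>+\<theta>. ennreal (normal_density 0 (sqrt u) \<theta>) * h \<theta> \<partial>lborel) \<partial>lborel)"
    by (intro nn_integral_cong) (simp add: nn_integral_cmult mult.assoc)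
  finally show ?thesis .
qed

lemma sets_normal_scale_mixture [simp, measurable_cong]: "sets (normal_scale_mixture U) = sets borel"
  by (simp add: normal_scale_mixture_def)

text \<open>The normalising constant of Bayes' formula is pulled out of the integral. If the
  quotient is infinite, both sides take the default value 0.\<close>

lemma posterior_mse_eq:
  assumes [measurable_cong]: "sets P = sets borel"
  shows "posterior_mse P y =
    enn2real ((\<integral>\<^sup>+\<theta>. ennreal (normal_density \<theta> 1 y * (\<theta> - y)\<^sup>2) \<partial>P)
      / (\<integral>\<^sup>+\<theta>. ennreal (normal_density \<theta> 1 y) \<partial>P))"
proof -
  let ?D = "\<integral>\<^sup>+\<theta>. ennreal (normal_density \<theta> 1 y) \<partial>P"
  have m [measurable]: "(\<lambda>\<theta>. normal_density \<theta> 1 y) \<in> borel_measurable P"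
    by (simp add: measurable_cong_sets[OF assms refl])
  have m2 [measurable]: "(\<lambda>\<theta>. (\<theta> - y)\<^sup>2) \<in> borel_measurable P"
    by (simp add: measurable_cong_sets[OF assms refl])
  have "posterior_mse P y = enn2real (\<integral>\<^sup>+\<theta>. ennreal ((\<theta> - y)\<^sup>2) \<partial>posterior P y)"
    unfolding posterior_mse_def posterior_def by (rule integral_eq_nn_integral) auto
  also have "(\<integral>\<^sup>+\<theta>. ennreal ((\<theta> - y)\<^sup>2) \<partial>posterior P y)
      = (\<integral>\<^sup>+\<theta>. ennreal (normal_density \<theta> 1 y) / ?D * ennreal ((\<theta> - y)\<^sup>2) \<partial>P)"
    unfolding posterior_def by (rule nn_integral_density) auto
  also have "\<dots> = (\<integral>\<^sup>+\<theta>. ennreal (normal_density \<theta> 1 y * (\<theta> - y)\<^sup>2) / ?D \<partial>P)"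
    by (simp add: ennreal_mult ennreal_times_divide mult.commute)
  also have "\<dots> = (\<integral>\<^sup>+\<theta>. ennreal (normal_density \<theta> 1 y * (\<theta> - y)\<^sup>2) \<partial>P) / ?D"
    by (rule nn_integral_divide) auto
  finally show ?thesis .
qed

text \<open>Shows the marginal density of \<open>y\<close> given \<open>u\<close> as the weight in
  \<open>kernel_laplace\<close> with \<open>s = 1/2\<close> and \<open>t = y^2 / 2\<close>.\<close>

lemma normal_density_sqrt_eq:
  assumes "u > 0"
  shows "normal_density 0 (sqrt (1 + u)) y
    = 1 / sqrt (2 * pi) * ((1 + u) powr (- (1/2)) * exp (- (y\<^sup>2 / 2) / (1 + u)))"
  using assms by (simp add: normal_density_def real_sqrt_mult powr_minus powr_half_sqrt divide_simps)

text \<open>Averages the conditional mean squared error \<open>1 - \<kappa> + y^2 \<kappa>^2\<close>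
  over the posterior of \<open>u\<close>; each factor \<kappa> raises \<open>s\<close> by 1. The
  assumption \<open>pos\<close> makes the denominator nonzero.\<close>

lemma posterior_mse_mixing_law:
  assumes k: "integrable lborel (mixing_kernel a b \<gamma>)"
    and pos: "kernel_laplace a b \<gamma> (1/2) (y\<^sup>2 / 2) > 0"
  shows "posterior_mse (normal_scale_mixture (mixing_law a b \<gamma>)) y =
    1 - kernel_laplace a b \<gamma> (3/2) (y\<^sup>2 / 2) / kernel_laplace a b \<gamma> (1/2) (y\<^sup>2 / 2)
      + y\<^sup>2 * (kernel_laplace a b \<gamma> (5/2) (y\<^sup>2 / 2) / kernel_laplace a b \<gamma> (1/2) (y\<^sup>2 / 2))"
proof -
  let ?k = "mixing_kernel a b \<gamma>"
  let ?J = "\<lambda>s. kernel_laplace a b \<gamma> s (y\<^sup>2 / 2)"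
  let ?g = "\<lambda>s u. (1 + u) powr (- s) * exp (- (y\<^sup>2 / 2) / (1 + u))"
  let ?P = "normal_scale_mixture (mixing_law a b \<gamma>)"
  define R where "R = 1 / sqrt (2 * pi)"
  define Z where "Z = (\<integral>u. ?k u \<partial>lborel)"
  have R: "R > 0" by (simp add: R_def)
  have Z_eq: "(\<integral>\<^sup>+u. ennreal (?k u) \<partial>lborel) = ennreal Z"
    unfolding Z_def using k by (intro nn_integral_eq_integral) (auto simp: mixing_kernel_nonneg)
  have int: "integrable lborel (\<lambda>u. ?k u * ?g s u)" if "s \<ge> 0" for s
    using k that by (intro integrable_kernel_laplace) auto
  \<comment> \<open>If \<open>Z\<close> were 0, the kernel would vanish almost everywhere, and with
    it the integral assumed positive in \<open>pos\<close>.\<close>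
  have Z: "Z > 0"
  proof (rule ccontr)
    assume "\<not> Z > 0"
    then have "(\<integral>\<^sup>+u. ennreal (?k u) \<partial>lborel) = 0"
      unfolding Z_eq by (simp add: ennreal_eq_0_iff)
    then have "AE u in lborel. ennreal (?k u) = 0"
      by (subst (asm) nn_integral_0_iff_AE) auto
    then have "AE u in lborel. ?k u = 0"
      by eventually_elim (simp add: ennreal_eq_0_iff mixing_kernel_nonneg antisym)
    then have "?J (1/2) = (\<integral>u. 0 \<partial>(lborel :: real measure))"
      unfolding kernel_laplace_def by (intro integral_cong_AE) auto
    with pos show False by simp
  qed
  have law: "mixing_law a b \<gamma> = density lborel (\<lambda>u. ennreal (?k u / Z))"
    unfolding mixing_law_def Z_eq using Z by (simp add: divide_ennreal mixing_kernel_nonneg)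
  \<comment> \<open>\<open>H u\<close> is the posterior mean of \<open>h\<close> given both
    \<open>y\<close> and \<open>u\<close>. Taking \<open>h = 1\<close> gives the denominator, and
    the squared distance to \<open>y\<close> gives the numerator.\<close>
  have P_int: "(\<integral>\<^sup>+\<theta>. ennreal (normal_density \<theta> 1 y * h \<theta>) \<partial>?P) = ennreal (R / Z * (\<integral>u. ?k u * (?g (1/2) u * H u) \<partial>lborel))"
    if h: "h \<in> borel_measurable borel" "\<And>\<theta>. h \<theta> \<ge> 0" and H: "\<And>u. u > 0 \<Longrightarrow> H u \<ge> 0"
      and hH: "\<And>u. u > 0 \<Longrightarrow>
        (\<integral>\<^sup>+\<theta>. ennreal (normal_density (u * y / (1 + u)) (sqrt (u / (1 + u))) \<theta> * h \<theta>) \<partial>lborel) = ennreal (H u)"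
      and i: "integrable lborel (\<lambda>u. ?k u * (?g (1/2) u * H u))"
    for h H :: "real \<Rightarrow> real"
  proof -
    note h(1)[measurable]
    have "(\<integral>\<^sup>+\<theta>. ennreal (normal_density \<theta> 1 y * h \<theta>) \<partial>?P) = (\<integral>\<^sup>+u. ennreal (?k u / Z) *
        (\<integral>\<^sup>+\<theta>. ennreal (normal_density 0 (sqrt u) \<theta>) * ennreal (normal_density \<theta> 1 y * h \<theta>) \<partial>lborel) \<partial>lborel)"
      unfolding law by (rule nn_integral_normal_scale_mixture) auto
    also have "\<dots> = (\<integral>\<^sup>+u. ennreal (R / Z * (?k u * (?g (1/2) u * H u))) \<partial>lborel)"
    proof (rule nn_integral_cong)
      fix u :: real
      show "ennreal (?k u / Z) *
        (\<integral>\<^sup>+\<theta>. ennreal (normal_density 0 (sqrt u) \<theta>) * ennreal (normal_density \<theta> 1 y * h \<theta>) \<partial>lborel)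
        = ennreal (R / Z * (?k u * (?g (1/2) u * H u)))"
      proof (cases "u > 0")
        case False
        then show ?thesis by (simp add: mixing_kernel_def)
      next
        case True
        let ?M = "\<lambda>\<theta>. normal_density (u * y / (1 + u)) (sqrt (u / (1 + u))) \<theta>"
        have "(\<integral>\<^sup>+\<theta>. ennreal (normal_density 0 (sqrt u) \<theta>) * ennreal (normal_density \<theta> 1 y * h \<theta>) \<partial>lborel)
          = (\<integral>\<^sup>+\<theta>. ennreal (normal_density 0 (sqrt (1 + u)) y) * ennreal (?M \<theta> * h \<theta>) \<partial>lborel)"
          using h(2) normal_density_mult[OF True, of _ y]
          by (intro nn_integral_cong) (simp add: ennreal_mult'[symmetric] mult.assoc[symmetric])
        also have "\<dots> = ennreal (normal_density 0 (sqrt (1 + u)) y) * ennreal (H u)"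
          by (subst nn_integral_cmult) (auto simp: hH[OF True])
        also have "\<dots> = ennreal (R * (?g (1/2) u * H u))"
          unfolding normal_density_sqrt_eq[OF True] R_def
          by (simp add: ennreal_mult'[symmetric] mult.assoc)
        finally show ?thesis
          using Z R H[OF True] by (simp add: ennreal_mult'[symmetric] mixing_kernel_nonneg mult_ac)
      qed
    qed
    also have "\<dots> = ennreal (\<integral>u. R / Z * (?k u * (?g (1/2) u * H u)) \<partial>lborel)"
    proof (intro nn_integral_eq_integral integrable_mult_right i AE_I2)
      fix u :: real
      show "0 \<le> R / Z * (?k u * (?g (1/2) u * H u))"
      proof (cases "u > 0")
        case True
        then show ?thesis using Z R H[OF True] by (simp add: mixing_kernel_nonneg)
      qed (simp add: mixing_kernel_def)
    qed
    finally show ?thesis by simp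
  qed
  have D: "(\<integral>\<^sup>+\<theta>. ennreal (normal_density \<theta> 1 y) \<partial>?P) = ennreal (R / Z * ?J (1/2))"
    using P_int[of "\<lambda>_. 1" "\<lambda>_. 1"] int[of "1/2"]
    by (simp add: nn_integral_normal_density kernel_laplace_def)
  let ?H = "\<lambda>u. u / (1 + u) + (u * y / (1 + u) - y)\<^sup>2"
  have H: "?k u * (?g (1/2) u * ?H u)
      = ?k u * ?g (1/2) u - ?k u * ?g (3/2) u + y\<^sup>2 * (?k u * ?g (5/2) u)" for u
  proof (cases "u > 0")
    case True
    have "u * y / (1 + u) - y = - (y / (1 + u))"
      using True by (simp add: field_simps)
    then have h1: "?H u = 1 - 1 / (1 + u) + y\<^sup>2 * (1 / (1 + u)\<^sup>2)"
      using True by (simp add: power_divide divide_simps)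
    have h2: "(1 + u) powr (- (3/2)) = (1 + u) powr (- (1/2)) * (1 / (1 + u))"
      using True powr_add[of "1 + u" "- (1/2)" "-1"] by (simp add: powr_minus divide_simps)
    have h3: "(1 + u) powr (- (5/2)) = (1 + u) powr (- (1/2)) * (1 / (1 + u)\<^sup>2)"
      using True powr_add[of "1 + u" "- (1/2)" "-2"] by (simp add: powr_minus divide_simps)
    show ?thesis
      unfolding h1 h2 h3 by (simp only: algebra_simps)
  qed (simp add: mixing_kernel_def)
  have N: "(\<integral>\<^sup>+\<theta>. ennreal (normal_density \<theta> 1 y * (\<theta> - y)\<^sup>2) \<partial>?P)
      = ennreal (R / Z * (?J (1/2) - ?J (3/2) + y\<^sup>2 * ?J (5/2)))"
  proof (subst P_int[of "\<lambda>\<theta>. (\<theta> - y)\<^sup>2" ?H])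
    show "integrable lborel (\<lambda>u. ?k u * (?g (1/2) u * ?H u))"
      unfolding H using int[of "1/2"] int[of "3/2"] int[of "5/2"] by auto
    show "ennreal (R / Z * (\<integral>u. ?k u * (?g (1/2) u * ?H u) \<partial>lborel))
        = ennreal (R / Z * (?J (1/2) - ?J (3/2) + y\<^sup>2 * ?J (5/2)))"
      unfolding H kernel_laplace_def using int[of "1/2"] int[of "3/2"] int[of "5/2"] by simp
  qed (auto simp: nn_integral_normal_density_sq_dist)
  \<comment> \<open>Needed because \<open>ennreal\<close> sends negative reals to 0, so the quotient
    returns to the reals only for a nonnegative numerator.\<close>
  have N0: "?J (1/2) - ?J (3/2) + y\<^sup>2 * ?J (5/2) \<ge> 0"
  proof -
    have "?J (1/2) - ?J (3/2) + y\<^sup>2 * ?J (5/2) = (\<integral>u. ?k u * (?g (1/2) u * ?H u) \<partial>lborel)"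
      unfolding H kernel_laplace_def using int[of "1/2"] int[of "3/2"] int[of "5/2"] by simp
    also have "\<dots> \<ge> 0"
    proof (intro integral_nonneg_AE AE_I2)
      show "0 \<le> ?k u * (?g (1/2) u * ?H u)" for u
        by (cases "u > 0") (auto simp: mixing_kernel_nonneg, simp add: mixing_kernel_def)
    qed
    finally show ?thesis .
  qed
  have "posterior_mse ?P y = (R / Z * (?J (1/2) - ?J (3/2) + y\<^sup>2 * ?J (5/2))) / (R / Z * ?J (1/2))"
    unfolding posterior_mse_eq[OF sets_normal_scale_mixture] N D
    using N0 R Z pos by (subst divide_ennreal) auto
  also have "\<dots> = (?J (1/2) - ?J (3/2) + y\<^sup>2 * ?J (5/2)) / ?J (1/2)"
    using R Z by simp
  also have "\<dots> = 1 - ?J (3/2) / ?J (1/2) + y\<^sup>2 * (?J (5/2) / ?J (1/2))"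
    using pos by (simp add: add_divide_distrib diff_divide_distrib)
  finally show ?thesis .
qed

section \<open>The expansion for large observations\<close>

theorem theorem2:
  fixes a b \<gamma> :: real
  assumes "(a > 0 \<and> b \<ge> 0 \<and> \<gamma> > 0) \<or> (a > 0 \<and> b > 0 \<and> \<gamma> = -1)"
  shows "(\<lambda>y::real. posterior_mse (normal_scale_mixture (mixing_law a b \<gamma>)) y
            - (1 + 2 / y\<^sup>2 * (1 + b) * (1 + 2 * b)))
         \<in> o[at_infinity](\<lambda>y. 1 / y\<^sup>2)"
proof -
  let ?J = "kernel_laplace a b \<gamma>"
  define r where "r = b + 1/2"
  define I where "I q = (\<integral>x. inv_gamma q x \<partial>lborel)" for q
  define A where "A s t = t powr (b + s) * (1 + ln t) powr (1 + \<gamma>) * ?J s t" for s t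
  have k: "integrable lborel (mixing_kernel a b \<gamma>)"
    using assms by (intro integrable_mixing_kernel) auto
  have r: "r > 0" using assms by (auto simp: r_def)
  have A: "(A s \<longlongrightarrow> I (b + s)) at_top" if "s > 0" for s
    unfolding A_def I_def using assms k that by (intro kernel_laplace_tendsto) auto
  have I0: "I r > 0" using r by (simp add: I_def integral_inv_gamma_pos)
  have I1: "I (r + 1) = r * I r"
    using r unfolding I_def by (rule integral_inv_gamma_plus_one)
  have I2: "I (r + 2) = (r + 1) * r * I r"
    using integral_inv_gamma_plus_one[of "r + 1"] r I1 by (simp add: I_def add.assoc)
  have A1: "(A (1/2) \<longlongrightarrow> I r) at_top" and A3: "(A (3/2) \<longlongrightarrow> I (r + 1)) at_top"
    and A5: "(A (5/2) \<longlongrightarrow> I (r + 2)) at_top"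
    using A[of "1/2"] A[of "3/2"] A[of "5/2"] by (auto simp: r_def algebra_simps)
  \<comment> \<open>This is \<open>y^2 (MSE - 1)\<close> with \<open>y^2 = 2 t\<close>. The
    normalisations of \<open>A (3/2)\<close> and \<open>A (5/2)\<close> exceed that of
    \<open>A (1/2)\<close> by exactly \<open>t\<close> and \<open>t^2\<close>; the log factors
    cancel.\<close>
  define M where "M t = 4 * (A (5/2) t / A (1/2) t) - 2 * (A (3/2) t / A (1/2) t)" for t
  have "(M \<longlongrightarrow> 4 * (I (r + 2) / I r) - 2 * (I (r + 1) / I r)) at_top"
    unfolding M_def using I0 by (intro tendsto_intros A1 A3 A5) auto
  moreover have "4 * (I (r + 2) / I r) - 2 * (I (r + 1) / I r) = 2 * (1 + b) * (1 + 2 * b)"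
  proof -
    have "I (r + 2) / I r = (r + 1) * r" "I (r + 1) / I r = r"
      using I0 by (auto simp: I1 I2)
    then show ?thesis
      by (simp only: r_def) (simp add: algebra_simps)
  qed
  ultimately have M: "(M \<longlongrightarrow> 2 * (1 + b) * (1 + 2 * b)) at_top"
    by simp
  have lim: "LIM y at_infinity. y\<^sup>2 / 2 :> (at_top :: real filter)"
  proof -
    have "LIM y at_infinity. norm (y :: real) ^ 2 * (1 / 2) :> (at_top :: real filter)"
      by (intro filterlim_at_top_mult_tendsto_pos[OF tendsto_const]
        filterlim_pow_at_top filterlim_norm_at_top) auto
    then show ?thesis by simp
  qed
  \<comment> \<open>The positive limit \<open>I r\<close> supplies the positive denominator for
    large \<open>t\<close>.\<close>
  have pos: "\<forall>\<^sub>F t in at_top. t \<ge> 1 \<and> A (1/2) t > 0"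
    using order_tendstoD(1)[OF A1 I0] eventually_ge_at_top[of 1] by eventually_elim auto
  \<comment> \<open>An exact identity for large \<open>\<bar>y\<bar>\<close>; asymptotics enter only
    afterwards, through the limit of \<open>M\<close>.\<close>
  have "\<forall>\<^sub>F y in at_infinity. posterior_mse (normal_scale_mixture (mixing_law a b \<gamma>)) y
      - (1 + 2 / y\<^sup>2 * (1 + b) * (1 + 2 * b)) = (M (y\<^sup>2 / 2) - 2 * (1 + b) * (1 + 2 * b)) * (1 / y\<^sup>2)"
    using eventually_compose_filterlim[OF pos lim]
  proof eventually_elim
    case (elim y)
    define t where "t = y\<^sup>2 / 2"
    have t: "t \<ge> 1" and At: "A (1/2) t > 0" using elim by (auto simp: t_def)
    define c where "c = t powr r * (1 + ln t) powr (1 + \<gamma>)"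
    have "1 + ln t > 0" using t by (intro add_pos_nonneg) auto
    then have c: "c > 0" using t by (simp add: c_def)
    have 1: "A (1/2) t = c * ?J (1/2) t"
      by (simp add: A_def c_def r_def)
    have 3: "A (3/2) t = c * (t * ?J (3/2) t)"
      using t powr_add[of t r 1] by (simp add: A_def c_def r_def add.assoc mult_ac)
    have 5: "A (5/2) t = c * (t\<^sup>2 * ?J (5/2) t)"
      using t powr_add[of t r 2] by (simp add: A_def c_def r_def add.assoc mult_ac)
    have J: "?J (1/2) t > 0"
      using At c unfolding 1 by (simp add: zero_less_mult_iff)
    have y: "y\<^sup>2 = 2 * t" by (simp add: t_def)
    \<comment> \<open>\<open>p\<close> and \<open>q\<close> are the posterior means of \<kappa> and
      \<kappa>^2.\<close>
    define p where "p = ?J (3/2) t / ?J (1/2) t"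
    define q where "q = ?J (5/2) t / ?J (1/2) t"
    have Mt: "M t = 4 * (t\<^sup>2 * q) - 2 * (t * p)"
      unfolding M_def 1 3 5 p_def q_def using c by simp
    have mse: "posterior_mse (normal_scale_mixture (mixing_law a b \<gamma>)) y = 1 - p + 2 * t * q"
      using posterior_mse_mixing_law[OF k, of y] J unfolding t_def[symmetric] y p_def q_def by simp
    show ?case
      unfolding mse y using t by (simp add: Mt field_simps power2_eq_square)
  qed
  moreover have "((\<lambda>y. M (y\<^sup>2 / 2) - 2 * (1 + b) * (1 + 2 * b)) \<longlongrightarrow> 0) at_infinity"
    using tendsto_diff[OF filterlim_compose[OF M lim] tendsto_const[of "2 * (1 + b) * (1 + 2 * b)"]]
    by simp
  then have "(\<lambda>y. (M (y\<^sup>2 / 2) - 2 * (1 + b) * (1 + 2 * b)) * (1 / y\<^sup>2)) \<in> o[at_infinity](\<lambda>y. 1 * (1 / y\<^sup>2))"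
    by (intro landau_o.small.mult_right) (auto intro: smalloI_tendsto)
  ultimately show ?thesis
    by (subst landau_o.small.in_cong) auto
qed

end
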